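(* Let $x\in\Sigma_q^n$, $\ell\ge2$ and $t\ge1$. Suppose that $\mathcal R'$ is obtained from $\mathcal R_\ell(\tilde x)$ by deleting $t$ arbitrary $\ell$-mers. Then: (i) We can insert a minimum number $s$ of $\ell$-mers into $\mathcal R'$ to get a consistent vector $\mathcal R''$ of $\ell$-mers, where $0\le s\le t$. The value of $s$ can be determined directly (from $\mathcal R'$). (ii) The sequence $\mathcal R_\ell^{-1}(\mathcal R'')$ is obtained from $\tilde x$ by some bursts of deletions. The total length of these bursts is $t-s$. (iii) If $s<\min\{\ell-1,t\}$, each of the burst-deletions in (ii) occurs in a maximal periodic substring whose minimum period is at most $t-s$. (iv) If $s<t\le\ell-2$, the minimum period of each of the maximal periodic substrings in (iii) divides the number of deleted symbols in that substring. In other words, each of these substrings undergoes a deletion of several complete minimum periods. (v) Let $p$ be one of the maximal periodic substrings in (iii), and let $p'$ be the sequence corresponding to $p$ after the deletions. Then $|p'|\ge\ell-1-s$. (vi) Let $p$ and $p'$ be as in (v), in the situation of (iv) (that is, $s<t\le\ell-2$). The minimum period of $p$ is also a period of $p'$.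
   Context: $q\ge2$, $\Sigma_q=\{0,1,\dots,q-1\}$; $z_{[a,b]}=z_az_{a+1}\cdots z_b$ denotes a substring. An $\ell$-mer is an element of $\Sigma_q^\ell$. A burst of deletions ($h$-burst-deletion) in a sequence is the deletion of a substring (of length $h$). Channel: two known $\ell$-mers $u,v\in\Sigma_q^\ell$ are fixed, and $\tilde x=uxv$, with coordinates indexed by $-\ell+1,\dots,n+\ell$, so that $\tilde x_{[-\ell+1,0]}=u$, $\tilde x_{[1,n]}=x$, $\tilde x_{[n+1,n+\ell]}=v$. The read vector is $\mathcal R_\ell(\tilde x)=(s_0,s_1,\dots,s_{n+\ell})$ with $s_i=\tilde x_{[i-\ell+1,i]}$. Deleting $\ell$-mers means passing to a (not necessarily contiguous) subvector; throughout it is assumed that the first and last $\ell$-mers $s_0$ and $s_{n+\ell}$ are not deleted. Consistency: two $\ell$-mers $y_1\cdots y_\ell$ and $z_1\cdots z_\ell$ (in this order) are consistent if $y_2\cdots y_\ell=z_1\cdots z_{\ell-1}$. A vector of $\ell$-mers is consistent if every two adjacent entries are consistent. For a consistent vector $(r_1,\dots,r_m)$ with $r_i=r_{i,1}\cdots r_{i,\ell}$, $\mathcal R_\ell^{-1}(r_1,\dots,r_m)$ denotes the sequence $r_{1,1}\cdots r_{1,\ell}r_{2,\ell}\cdots r_{m,\ell}$. Periodicity: a sequence $z$ of length at least $T+1$ is $T$-periodic (has period $T$) if $z_i=z_{i+T}$ for all $1\le i\le |z|-T$; its minimum period is its smallest period. A maximal $T$-periodic substring of $z$ is a $T$-periodic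 substring not contained in a longer $T$-periodic substring of $z$; "maximal periodic substring with minimum period $T$" means a maximal $T$-periodic substring whose minimum period is $T$. Deleting several complete minimum periods from a periodic sequence with minimum period $T$ means applying several bursts of deletions, each of length divisible by $T$. Several bursts may lie in the same maximal periodic substring, in which case they are regarded as applied to it sequentially. *)

theory Defs
  imports Main "HOL-Library.Sublist"
begin

definition words :: "nat \<Rightarrow> nat \<Rightarrow> nat list set" where
  "words q m = {w. length w = m \<and> set w \<subseteq> {..<q}}"

text \<open>Lists are indexed from 0, so the entry with index \<open>i\<close> of the padded sequence \<open>u @ x @ v\<close>
  has coordinate \<open>i - l + 1\<close> in the numbering in which \<open>x\<close> occupies \<open>1, \<dots>, n\<close>; the entries of
  the read vector are numbered \<open>0, \<dots>, n + l\<close> in both conventions.\<close>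

definition reads :: "nat \<Rightarrow> nat list \<Rightarrow> nat list list" where
  "reads l w = map (\<lambda>i. take l (drop i w)) [0..<length w + 1 - l]"

text \<open>The index set \<open>D\<close> of deleted entries avoids the first and the last entry.\<close>

definition deletes_lmers :: "nat \<Rightarrow> nat list list \<Rightarrow> nat list list \<Rightarrow> bool" where
  "deletes_lmers t R R' \<longleftrightarrow> (\<exists>D. D \<subseteq> {1..<length R - 1} \<and> card D = t \<and> R' = nths R (- D))"

definition consistent :: "nat list list \<Rightarrow> bool" where
  "consistent R \<longleftrightarrow> successively (\<lambda>y z. tl y = butlast z) R"

definition read_inverse :: "nat list list \<Rightarrow> nat list" where
  "read_inverse R = hd R @ map last (tl R)"

definition consistent_insertion ::
    "nat \<Rightarrow> nat \<Rightarrow> nat \<Rightarrow> nat list list \<Rightarrow> nat list list \<Rightarrow> bool" where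
  "consistent_insertion q l s R' R'' \<longleftrightarrow>
     subseq R' R'' \<and> length R'' = length R' + s \<and> set R'' \<subseteq> words q l \<and> consistent R''"

definition min_insertions :: "nat \<Rightarrow> nat \<Rightarrow> nat list list \<Rightarrow> nat" where
  "min_insertions q l R' = (LEAST s. \<exists>R''. consistent_insertion q l s R' R'')"

text \<open>The least \<open>d\<close> such that the last \<open>l - 1 - d\<close> symbols of \<open>y\<close> are the first \<open>l - 1 - d\<close>
  symbols of \<open>z\<close>; \<open>d = l - 1\<close> (empty overlap) always qualifies.\<close>

definition gap :: "nat \<Rightarrow> nat list \<Rightarrow> nat list \<Rightarrow> nat" where
  "gap l y z = (LEAST d. drop (d + 1) y = take (l - (d + 1)) z)"

definition has_period :: "'a list \<Rightarrow> nat \<Rightarrow> bool" where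
  "has_period z T \<longleftrightarrow>
     1 \<le> T \<and> T + 1 \<le> length z \<and> (\<forall>i. i + T < length z \<longrightarrow> z ! i = z ! (i + T))"

definition min_period :: "'a list \<Rightarrow> nat" where
  "min_period z = (LEAST T. has_period z T)"

text \<open>Substrings are occurrences, not words: \<open>(a, b)\<close> stands for the positions \<open>a, \<dots>, b - 1\<close>.\<close>

fun span :: "nat \<times> nat \<Rightarrow> nat set" where
  "span (a, b) = {a..<b}"

definition substring :: "'a list \<Rightarrow> nat \<times> nat \<Rightarrow> 'a list" where
  "substring z p = nths z (span p)"

definition maximal_periodic :: "'a list \<Rightarrow> nat \<Rightarrow> nat \<times> nat \<Rightarrow> bool" where
  "maximal_periodic z T p \<longleftrightarrow>
     span p \<subseteq> {..<length z} \<and> has_period (substring z p) T \<and>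
     \<not> (\<exists>p'. span p' \<subseteq> {..<length z} \<and> span p \<subset> span p' \<and> has_period (substring z p') T)"

definition maximal_periodic_min :: "'a list \<Rightarrow> nat \<Rightarrow> nat \<times> nat \<Rightarrow> bool" where
  "maximal_periodic_min z T p \<longleftrightarrow> maximal_periodic z T p \<and> min_period (substring z p) = T"

text \<open>A family of bursts of deletions is a finite set of nonempty, pairwise disjoint substrings,
  in the coordinates of the original sequence.\<close>

definition bursts :: "'a list \<Rightarrow> (nat \<times> nat) set \<Rightarrow> bool" where
  "bursts z B \<longleftrightarrow>
     finite B \<and> (\<forall>\<beta>\<in>B. span \<beta> \<noteq> {} \<and> span \<beta> \<subseteq> {..<length z}) \<and>
     (\<forall>\<beta>\<in>B. \<forall>\<gamma>\<in>B. \<beta> \<noteq> \<gamma> \<longrightarrow> span \<beta> \<inter> span \<gamma> = {})"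

text \<open>\<open>after_bursts z p C\<close> is what remains of the substring \<open>p\<close> of \<open>z\<close> once the bursts in \<open>C\<close> have
  been applied to it.\<close>

definition after_bursts :: "'a list \<Rightarrow> nat \<times> nat \<Rightarrow> (nat \<times> nat) set \<Rightarrow> 'a list" where
  "after_bursts z p C = nths z (span p - \<Union> (span ` C))"

text \<open>Maximal periodic substrings may overlap. \<open>P\<close> records in which of them each burst takes
  place; the bursts applied to \<open>p\<close> are those which \<open>P\<close> attributes to \<open>p\<close>.\<close>

definition bursts_in :: "(nat \<times> nat) set \<Rightarrow> (nat \<times> nat \<Rightarrow> nat \<times> nat) \<Rightarrow> nat \<times> nat \<Rightarrow> (nat \<times> nat) set" where
  "bursts_in B P p = {\<beta> \<in> B. P \<beta> = p}"

end

theory Submission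
  imports Defs
begin

text \<open>A shortest consistent insertion fills each gap between neighbouring surviving reads separately,
  so it is forced: neighbours at true distance \<open>k + 1\<close> get glued at distance \<open>g + 1\<close>, where \<open>g \<le> k\<close>
  is their gap, and this deletes \<open>k - g\<close> consecutive symbols of \<open>X\<close>. If \<open>0 < k - g\<close> and \<open>g < l - 1\<close>,
  the two reads overlap at both distances, so the \<open>l - 1 - g + (k - g)\<close> symbols around the deleted
  ones have period \<open>k - g\<close>; if moreover the minimum period \<open>T\<close> is at most \<open>l - 1 - g\<close>, then
  \<open>T\<close> divides \<open>k - g\<close> by a Fine--Wilf argument. The \<open>l - 1 - g\<close> symbols in front of the first burst
  in a maximal periodic substring survive.\<close>

section \<open>Minimal consistent insertions\<close>

text \<open>Each consistent step shifts the window by one symbol, so the overlap shrinks by one per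
  step; for long chains both sides are empty.\<close>

lemma consistent_chain_overlap:
  assumes "consistent (y # mid @ [z])" "\<forall>w\<in>set (y # mid @ [z]). length w = l"
  shows "drop (Suc (length mid)) y = take (l - Suc (length mid)) z"
  using assms
proof (induction mid arbitrary: y)
  case Nil
  then show ?case by (simp add: consistent_def drop_Suc butlast_conv_take)
next
  case (Cons m mid)
  have "drop (Suc (length mid)) m = take (l - Suc (length mid)) z"
    using Cons.prems by (intro Cons.IH) (auto simp: consistent_def)
  moreover have "tl y = butlast m"
    using Cons.prems by (simp add: consistent_def)
  ultimately have "drop (Suc (Suc (length mid))) y = butlast (take (l - Suc (length mid)) z)"
    by (metis drop_Suc drop_butlast)
  then show ?case
    using Cons.prems by (simp add: butlast_take)
qed

text \<open>These are the symbols that \<open>read_inverse\<close> appends on the way from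
  \<open>y\<close> to \<open>z\<close>. They depend only on \<open>z\<close> and the number of
  steps, so the choice of \<open>mid\<close> does not affect the resulting word.\<close>

lemma consistent_chain_last:
  assumes "consistent (y # mid @ [z])" "\<forall>w\<in>set (y # mid @ [z]). length w = l"
    and "length mid < l"
  shows "map last (mid @ [z]) = drop (l - Suc (length mid)) z"
  using assms
proof (induction mid arbitrary: y)
  case Nil
  then show ?case
    by (cases z rule: rev_cases) auto
next
  case (Cons m mid)
  let ?k = "l - Suc (length mid)"
  have tail: "consistent (m # mid @ [z])" "\<forall>w\<in>set (m # mid @ [z]). length w = l"
    using Cons.prems by (auto simp: consistent_def)
  have len: "length m = l" "length z = l" and k: "0 < ?k" "?k \<le> l"
    using Cons.prems by auto
  \<comment> \<open>Here \<open>Suc (length mid) < l\<close>, so the last symbol of \<open>m\<close>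
    is still visible in \<open>z\<close>, at the end of the overlap.\<close>
  have "last m = last (drop (Suc (length mid)) m)"
    using len k by (simp add: last_drop)
  also have "\<dots> = last (take ?k z)"
    using consistent_chain_overlap[OF tail] by simp
  also have "\<dots> = z ! (?k - 1)"
    using len k Cons.prems(3) by (subst last_conv_nth) auto
  finally have "map last ((m # mid) @ [z]) = z ! (?k - 1) # drop ?k z"
    using Cons.IH[OF tail] Cons.prems(3) by simp
  also have "\<dots> = drop (?k - 1) z"
    using len k by (metis Cons_nth_drop_Suc Suc_diff_1 Suc_le_lessD)
  finally show ?case by simp
qed

lemma consistent_chain_exists:
  assumes "y \<in> words q l" "z \<in> words q l"
    and "drop (Suc d) y = take (l - Suc d) z" "d < l"
  shows "\<exists>mid. length mid = d \<and> set mid \<subseteq> words q l \<and> consistent (y # mid @ [z])"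
  using assms
proof (induction d arbitrary: y)
  case 0
  then show ?case
    by (intro exI[of _ "[]"]) (auto simp: consistent_def words_def drop_Suc butlast_conv_take)
next
  case (Suc d)
  \<comment> \<open>The overlap of \<open>y\<close> and \<open>z\<close> has length
    \<open>l - Suc (Suc d)\<close>, so the appended symbol is the first one of \<open>z\<close>
    beyond it; \<open>m\<close> overlaps \<open>z\<close> in one symbol more.\<close>
  define m where "m = tl y @ [z ! (l - Suc (Suc d))]"
  have len: "length y = l" "length z = l"
    using Suc.prems by (auto simp: words_def)
  have "z ! (l - Suc (Suc d)) \<in> set z"
    using Suc.prems len by simp
  then have m: "m \<in> words q l"
    using Suc.prems by (cases y) (auto simp: m_def words_def subset_iff)
  have "drop (Suc d) m = drop (Suc (Suc d)) y @ [z ! (l - Suc (Suc d))]"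
    using len Suc.prems by (simp add: m_def drop_Suc)
  also have "\<dots> = take (Suc (l - Suc (Suc d))) z"
    using len Suc.prems by (simp add: take_Suc_conv_app_nth)
  finally have "drop (Suc d) m = take (l - Suc d) z"
    using Suc.prems by (simp add: Suc_diff_Suc)
  with Suc.IH[OF m] Suc.prems obtain mid
    where mid: "length mid = d" "set mid \<subseteq> words q l" "consistent (m # mid @ [z])"
    by auto
  then have "consistent (y # (m # mid) @ [z])"
    by (auto simp: consistent_def m_def)
  with mid m show ?case
    by (intro exI[of _ "m # mid"]) auto
qed

section \<open>Gaps and shortest consistent supersequences\<close>

lemma gap_le:
  assumes "drop (d + 1) y = take (l - (d + 1)) z"
  shows "gap l y z \<le> d"
  unfolding gap_def by (rule Least_le) (rule assms)

lemma gap_overlap: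
  assumes "length y = l"
  shows "drop (gap l y z + 1) y = take (l - (gap l y z + 1)) z"
  unfolding gap_def by (rule LeastI[of _ l]) (use assms in simp)

lemma gap_less:
  assumes "length y = l" "0 < l"
  shows "gap l y z < l"
proof -
  have "gap l y z \<le> l - 1"
    using assms by (intro gap_le) simp
  with assms show ?thesis by simp
qed

definition total_gap :: "nat \<Rightarrow> nat list list \<Rightarrow> nat" where
  "total_gap l R = (\<Sum>i<length R - 1. gap l (R ! i) (R ! (i + 1)))"

text \<open>Every read is laid over its predecessor with shift \<open>gap + 1\<close>, so it
  contributes its last \<open>gap + 1\<close> symbols.\<close>

definition glue :: "nat \<Rightarrow> nat list list \<Rightarrow> nat list" where
  "glue l R = hd R @ concat (map (\<lambda>i. drop (l - Suc (gap l (R ! i) (R ! (i + 1)))) (R ! (i + 1)))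
                              [0..<length R - 1])"

lemma total_gap_simps [simp]:
  "total_gap l [y] = 0"
  "total_gap l (y # z # R) = gap l y z + total_gap l (z # R)"
  unfolding total_gap_def by (simp_all add: sum.lessThan_Suc_shift del: sum.lessThan_Suc)

lemma glue_simps [simp]:
  "glue l [y] = y"
  "glue l (y # z # R) = y @ drop (l - Suc (gap l y z)) z @ drop (length z) (glue l (z # R))"
  unfolding glue_def by (simp_all add: map_upt_Suc del: upt_Suc)

text \<open>Two neighbours of \<open>y # R\<close> bound a chain inside \<open>S\<close>, whose
  interior has at least as many entries as their gap. If the total bound is attained, every chain
  has exactly that length, and \<open>consistent_chain_last\<close> determines the appended
  symbols.\<close>

lemma consistent_superseq:
  assumes "subseq (y # R) S" "consistent S" "\<forall>w\<in>set S. length w = l" "0 < l"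
  shows "length (y # R) + total_gap l (y # R) \<le> length S \<and>
    (length S = length (y # R) + total_gap l (y # R) \<longrightarrow>
      hd S = y \<and> read_inverse S = glue l (y # R))"
  using assms
proof (induction R arbitrary: y S)
  case Nil
  then obtain a b where S: "S = a @ y # b"
    using list_emb_ConsD[OF Nil.prems(1)] by auto
  then show ?case by (auto simp: read_inverse_def)
next
  case (Cons z R)
  obtain pre post where S: "S = pre @ y # post" and post: "subseq (z # R) post"
    using list_emb_ConsD[OF Cons.prems(1)] by auto
  obtain mid rest where post': "post = mid @ z # rest" and rest: "subseq R rest"
    using list_emb_ConsD[OF post] by auto
  have chain: "consistent (y # mid @ [z])" "\<forall>w\<in>set (y # mid @ [z]). length w = l"
    and cons: "consistent (z # rest)" "\<forall>w\<in>set (z # rest). length w = l"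
    using Cons.prems unfolding S post' consistent_def
    by (auto simp: successively_append_iff successively_Cons hd_append)
  have IH: "length (z # R) + total_gap l (z # R) \<le> length (z # rest)"
    "length (z # rest) = length (z # R) + total_gap l (z # R) \<Longrightarrow>
      read_inverse (z # rest) = glue l (z # R)"
    using Cons.IH[of z "z # rest"] rest cons Cons.prems(4) by auto
  have gap: "gap l y z \<le> length mid"
    using consistent_chain_overlap[OF chain] by (intro gap_le) simp
  have len: "length S = length pre + 1 + length mid + length (z # rest)"
    by (simp add: S post')
  show ?case
  proof (intro conjI impI)
    show "length (y # z # R) + total_gap l (y # z # R) \<le> length S"
      using IH(1) gap len by simp
    assume "length S = length (y # z # R) + total_gap l (y # z # R)"
    then have "length S = 1 + gap l y z + (length (z # R) + total_gap l (z # R))"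
      by simp
    \<comment> \<open>The sum of three lower bounds is attained, so each of them is.\<close>
    then have "length pre = 0" and mid: "length mid = gap l y z"
      and len': "length (z # rest) = length (z # R) + total_gap l (z # R)"
      using IH(1) gap len by linarith+
    then have pre: "pre = []"
      by simp
    have glue: "glue l (z # R) = z @ map last rest"
      using IH(2)[OF len'] by (simp add: read_inverse_def)
    have "length y = l"
      using chain by simp
    then have "map last (mid @ [z]) = drop (l - Suc (gap l y z)) z"
      using consistent_chain_last[OF chain] gap_less[of y l z] Cons.prems(4) mid by simp
    then show "hd S = y" "read_inverse S = glue l (y # z # R)"
      using glue by (simp_all add: S post' pre read_inverse_def)
  qed
qed

text \<open>A chain as long as the gap is put between any two neighbours. The form
  \<open>y # S\<close> of the result lets the next chain, which ends in its head, be attached in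
  front.\<close>

lemma consistent_superseq_exists:
  assumes "set (y # R) \<subseteq> words q l" "0 < l"
  shows "\<exists>S. consistent_insertion q l (total_gap l (y # R)) (y # R) (y # S)"
  using assms
proof (induction R arbitrary: y)
  case Nil
  then show ?case
    by (intro exI[of _ "[]"]) (auto simp: consistent_insertion_def consistent_def)
next
  case (Cons z R)
  then obtain S where S: "consistent_insertion q l (total_gap l (z # R)) (z # R) (z # S)"
    by fastforce
  have "length y = l"
    using Cons.prems by (simp add: words_def)
  then have "\<exists>mid. length mid = gap l y z \<and> set mid \<subseteq> words q l \<and> consistent (y # mid @ [z])"
    using Cons.prems gap_overlap[of y l z] gap_less[of y l z]
    by (intro consistent_chain_exists) auto
  then obtain mid where mid: "length mid = gap l y z" "set mid \<subseteq> words q l"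
    "consistent (y # mid @ [z])"
    by blast
  have "consistent ((y # mid @ [z]) @ S)"
    using mid(3) S unfolding consistent_insertion_def consistent_def
    by (subst successively_append_iff) (auto simp: successively_Cons)
  then have "consistent (y # mid @ z # S)"
    by simp
  moreover have "subseq (y # z # R) (y # mid @ z # S)"
    using S unfolding consistent_insertion_def
    by (simp add: subseq_drop_many)
  ultimately show ?case
    using mid S Cons.prems unfolding consistent_insertion_def
    by (intro exI[of _ "mid @ z # S"]) auto
qed

lemma min_insertions_eq:
  assumes "set R \<subseteq> words q l" "R \<noteq> []" "0 < l"
  shows "min_insertions q l R = total_gap l R"
    and "\<exists>S. consistent_insertion q l (total_gap l R) R S"
proof -
  obtain y R1 where R: "R = y # R1"
    using assms by (cases R) auto
  show ex: "\<exists>S. consistent_insertion q l (total_gap l R) R S"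
    using consistent_superseq_exists[of y R1 q l] assms unfolding R by blast
  show "min_insertions q l R = total_gap l R"
    unfolding min_insertions_def
  proof (rule Least_equality, rule ex)
    fix s assume "\<exists>S. consistent_insertion q l s R S"
    then obtain S where "consistent_insertion q l s R S" ..
    then show "total_gap l R \<le> s"
      using consistent_superseq[of y R1 S l] assms(3)
      unfolding R consistent_insertion_def words_def by auto
  qed
qed

text \<open>Since \<open>glue l R\<close> depends on \<open>R\<close> and \<open>l\<close> alone,
  all shortest insertions yield the same word; this serves the quantification over every
  \<open>R''\<close> in the theorem.\<close>

lemma read_inverse_min_insertion:
  assumes "consistent_insertion q l (total_gap l R) R S" "R \<noteq> []" "0 < l"
  shows "read_inverse S = glue l R"
proof -
  obtain y R1 where R: "R = y # R1"
    using assms by (cases R) auto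
  show ?thesis
    using consistent_superseq[of y R1 S l] assms
    unfolding R consistent_insertion_def words_def by auto
qed


section \<open>Periodic substrings\<close>

lemma nths_eq_map_filter: "nths z S = map ((!) z) (filter (\<lambda>i. i \<in> S) [0..<length z])"
proof (induction z rule: rev_induct)
  case (snoc c z)
  have "map ((!) (z @ [c])) (filter (\<lambda>i. i \<in> S) [0..<length z]) = nths z S"
    unfolding snoc by (auto simp: nth_append)
  then show ?case by (simp add: nths_append)
qed simp

text \<open>The origin \<open>k\<close> of a selected symbol comes with its rank in
  \<open>S\<close>; position minus rank later counts the deletions below \<open>k\<close>.\<close>

lemma nth_nths:
  assumes "i < length (nths z S)"
  shows "\<exists>k\<in>S. k < length z \<and> nths z S ! i = z ! k \<and> card {j \<in> S. j < k} = i"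
  using assms
proof (induction z rule: rev_induct)
    case (snoc c z)
    show ?case
    proof (cases "i < length (nths z S)")
      case True
      with snoc.IH obtain k where "k \<in> S" "k < length z" "nths z S ! i = z ! k"
        "card {j \<in> S. j < k} = i"
        by auto
      with True show ?thesis
        by (intro bexI[of _ k]) (simp_all add: nths_append nth_append)
    next
      case False
      with snoc.prems have "length z \<in> S" "i = length (nths z S)"
        by (auto simp: nths_append split: if_splits)
      moreover have "length (nths z S) = card {j \<in> S. j < length z}"
        unfolding length_nths by (rule arg_cong[of _ _ card]) auto
      ultimately show ?thesis
        by (intro bexI[of _ "length z"]) (auto simp: nths_append nth_append)
    qed
qed simp

lemma length_substring:
  assumes "b \<le> length z"
  shows "length (substring z (a, b)) = b - a"
proof -
  have "{i. i < length z \<and> i \<in> {a..<b}} = {a..<b}"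
    using assms by auto
  then show ?thesis by (simp add: substring_def length_nths)
qed

lemma nth_substring:
  assumes "b \<le> length z" "a + i < b"
  shows "substring z (a, b) ! i = z ! (a + i)"
proof -
  have "i < length (substring z (a, b))"
    using assms by (simp add: length_substring)
  then obtain k
    where k: "k \<in> {a..<b}" "substring z (a, b) ! i = z ! k" "card {j \<in> {a..<b}. j < k} = i"
    using nth_nths[of i z "{a..<b}"] unfolding substring_def span.simps by blast
  have "{j \<in> {a..<b}. j < k} = {a..<k}"
    using k(1) by auto
  then have "i = k - a"
    using k(3) by simp
  then have "k = a + i"
    using k(1) by simp
  with k show ?thesis by simp
qed

lemma has_period_substring_iff:
  assumes "b \<le> length z"
  shows "has_period (substring z (a, b)) T \<longleftrightarrow>
    1 \<le> T \<and> a + T < b \<and> (\<forall>i. a \<le> i \<and> i + T < b \<longrightarrow> z ! i = z ! (i + T))"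
proof -
  have "(\<forall>i. i + T < b - a \<longrightarrow> substring z (a, b) ! i = substring z (a, b) ! (i + T)) \<longleftrightarrow>
    (\<forall>i. a \<le> i \<and> i + T < b \<longrightarrow> z ! i = z ! (i + T))" (is "?L \<longleftrightarrow> ?R")
  proof
    assume L: ?L
    show ?R
    proof (intro allI impI)
      fix i assume i: "a \<le> i \<and> i + T < b"
      then have "i - a + T < b - a" by linarith
      with L have "substring z (a, b) ! (i - a) = substring z (a, b) ! (i - a + T)" by blast
      with i assms show "z ! i = z ! (i + T)"
        by (simp add: nth_substring)
    qed
  next
    assume ?R
    then show ?L
      using assms by (auto simp: nth_substring add.assoc[symmetric])
  qed
  with assms show ?thesis
    unfolding has_period_def by (auto simp: length_substring)
qed

section \<open>Minimum periods and maximal periodic extensions\<close>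

lemma min_period_properties:
  assumes "has_period w T"
  shows "has_period w (min_period w)" "min_period w \<le> T"
  unfolding min_period_def using assms by (auto intro: LeastI Least_le)

text \<open>A weak form of the Fine--Wilf theorem by subtractive Euclid:
  \<open>d - min_period w\<close> is again a period and inherits the length bound.\<close>

lemma min_period_dvd:
  assumes "has_period w d" "min_period w + d \<le> length w"
  shows "min_period w dvd d"
  using assms
proof (induction d rule: less_induct)
  case (less d)
  let ?T = "min_period w"
  have T: "has_period w ?T" "?T \<le> d"
    using min_period_properties[OF less.prems(1)] by auto
  show ?case
  proof (cases "?T = d")
    case False
    \<comment> \<open>Go right by \<open>d\<close> and back by \<open>?T\<close>; if that leaves the
      word, the length bound gives \<open>?T \<le> i\<close>, and one can go back first.\<close>
    have "w ! i = w ! (i + (d - ?T))" if i: "i + (d - ?T) < length w" for i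
    proof (cases "i + d < length w")
      case True
      then have "w ! i = w ! (i + d)"
        using less.prems(1) by (simp add: has_period_def)
      moreover have "w ! (i + (d - ?T)) = w ! (i + (d - ?T) + ?T)"
        using T True unfolding has_period_def by auto
      ultimately show ?thesis using T(2) by simp
    next
      case False
      then have "?T \<le> i" using less.prems(2) by simp
      then have "w ! (i - ?T) = w ! (i - ?T + ?T)"
        using T(1) i unfolding has_period_def by auto
      moreover have "w ! (i - ?T) = w ! (i - ?T + d)"
        using less.prems(1) i \<open>?T \<le> i\<close> T(2) unfolding has_period_def by auto
      ultimately show ?thesis
        using \<open>?T \<le> i\<close> T(2) by simp
    qed
    then have "has_period w (d - ?T)"
      using less.prems(1) T False by (auto simp: has_period_def)
    then have "?T dvd d - ?T"
      using less.IH[of "d - ?T"] less.prems T False by (auto simp: has_period_def)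
    with T(2) show ?thesis
      by (simp add: dvd_diff_nat dvd_minus_self)
  qed simp
qed

text \<open>A longest interval around \<open>(a, b)\<close> with period \<open>T\<close> is maximal.
  Its minimum period is still \<open>T\<close>, because a smaller period would restrict to
  \<open>(a, b)\<close>.\<close>

lemma maximal_periodic_min_extension:
  assumes "b \<le> length z" "has_period (substring z (a, b)) d"
  defines "T \<equiv> min_period (substring z (a, b))"
  obtains a' b' where "a' \<le> a" "b \<le> b'" "b' \<le> length z" "maximal_periodic_min z T (a', b')"
proof -
  define Q where "Q = (\<lambda>(c, e). c \<le> a \<and> b \<le> e \<and> e \<le> length z \<and> has_period (substring z (c, e)) T)"
  have T: "has_period (substring z (a, b)) T"
    unfolding T_def using min_period_properties assms(2) by blast
  then have ab: "a < b"
    using assms by (simp add: has_period_substring_iff)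
  have "Q (a, b)" using T assms(1) by (simp add: Q_def)
  moreover have "\<forall>p. Q p \<longrightarrow> snd p - fst p < Suc (length z)"
    by (auto simp: Q_def)
  ultimately obtain p where p: "Q p" "\<And>p'. Q p' \<Longrightarrow> snd p' - fst p' \<le> snd p - fst p"
    using ex_has_greatest_nat[of Q "(a, b)" "\<lambda>p. snd p - fst p"] by blast
  obtain a' b' where p_eq: "p = (a', b')" by fastforce
  have p': "a' \<le> a" "b \<le> b'" "b' \<le> length z" "has_period (substring z (a', b')) T"
    using p(1) by (auto simp: p_eq Q_def)
  have "maximal_periodic z T (a', b')"
    unfolding maximal_periodic_def
  proof (intro conjI notI)
    assume "\<exists>p'. span p' \<subseteq> {..<length z} \<and> span (a', b') \<subset> span p' \<and> has_period (substring z p') T"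
    then obtain c e where ce: "{c..<e} \<subseteq> {..<length z}" "{a'..<b'} \<subset> {c..<e}"
      "has_period (substring z (c, e)) T"
      by auto
    \<comment> \<open>An empty span says nothing about its endpoints; nonemptiness turns inclusions
      of spans into inequalities.\<close>
    have "c < e" using ce(2) by auto
    with ce(1) have e: "e \<le> length z"
      by (metis atLeastLessThan_subset_iff lessThan_atLeast0 not_le)
    have "c \<le> a'" "b' \<le> e"
      using ce(2) ab p' atLeastLessThan_subset_iff[of a' b' c e] by auto
    then have "e - c \<le> b' - a'"
      using p(2)[of "(c, e)"] ce(3) e p' by (simp add: Q_def p_eq)
    with \<open>c \<le> a'\<close> \<open>b' \<le> e\<close> ab p' have "c = a'" "e = b'" by auto
    with ce(2) show False by simp
  qed (use p' in auto)
  moreover have "min_period (substring z (a', b')) = T"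
    unfolding min_period_def[of "substring z (a', b')"]
  proof (rule Least_equality)
    fix T' assume T': "has_period (substring z (a', b')) T'"
    show "T \<le> T'"
    proof (rule ccontr)
      assume "\<not> T \<le> T'"
      then have "has_period (substring z (a, b)) T'"
        using T T' p' assms(1) by (auto simp: has_period_substring_iff)
      then show False
        using \<open>\<not> T \<le> T'\<close> min_period_properties(2) unfolding T_def by blast
    qed
  qed (use p' in simp)
  ultimately show ?thesis
    using p' that by (simp add: maximal_periodic_min_def)
qed

lemma period_cong_mod:
  assumes "\<And>i. a \<le> i \<Longrightarrow> i + T < b \<Longrightarrow> z ! i = z ! (i + T)"
    and "a \<le> i" "i \<le> j" "j < b" "T dvd j - i"
  shows "z ! i = z ! j"
proof -
  have "z ! i = z ! (i + m * T)" if "i + m * T < b" for m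
    using that
  proof (induction m)
    case (Suc m)
    then show ?case
      using assms(1)[of "i + m * T"] assms(2) by (simp add: algebra_simps)
  qed simp
  moreover obtain m where "j - i = m * T"
    using assms(5) by (metis dvd_div_mult_self)
  ultimately show ?thesis using assms by (metis le_add_diff_inverse)
qed

text \<open>Deleting whole periods does not change the residues modulo the period of the original
  positions of the surviving symbols.\<close>

lemma has_period_after_bursts:
  assumes "b \<le> length z" "has_period (substring z (a, b)) T"
    and C: "finite C" "\<And>\<beta>. \<beta> \<in> C \<Longrightarrow> span \<beta> \<subseteq> {a..<b}" "\<And>\<beta>. \<beta> \<in> C \<Longrightarrow> T dvd card (span \<beta>)"
    "\<And>\<beta> \<gamma>. \<beta> \<in> C \<Longrightarrow> \<gamma> \<in> C \<Longrightarrow> \<beta> \<noteq> \<gamma> \<Longrightarrow> span \<beta> \<inter> span \<gamma> = {}"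
    and len: "T < length (after_bursts z (a, b) C)"
  shows "has_period (after_bursts z (a, b) C) T"
proof -
  define S where "S = {a..<b} - \<Union> (span ` C)"
  have w: "after_bursts z (a, b) C = nths z S"
    by (simp add: after_bursts_def S_def)
  have T: "1 \<le> T" "\<And>i. a \<le> i \<Longrightarrow> i + T < b \<Longrightarrow> z ! i = z ! (i + T)"
    using assms(1,2) by (auto simp: has_period_substring_iff)
  \<comment> \<open>The difference of position and rank is the number of deleted positions in
    \<open>{a..<k}\<close>.\<close>
  have shift: "T dvd k - a - card {j \<in> S. j < k}" "card {j \<in> S. j < k} \<le> k - a" if "k \<in> S" for k
  proof -
    define C' where "C' = {\<beta> \<in> C. span \<beta> \<subseteq> {a..<k}}"
    have k: "a \<le> k" "k < b" using that by (auto simp: S_def)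
    \<comment> \<open>A burst is an interval missing the survivor \<open>k\<close>, so it lies on
      one side of \<open>k\<close> and is counted in full or not at all.\<close>
    have below: "span \<beta> \<subseteq> {a..<k}" if "\<beta> \<in> C" "j \<in> span \<beta>" "j < k" for \<beta> j
    proof -
      obtain c d where [simp]: "\<beta> = (c, d)" by fastforce
      have "k \<notin> span \<beta>" using \<open>k \<in> S\<close> that by (auto simp: S_def)
      with that C(2)[of \<beta>] show ?thesis by auto
    qed
    have union: "{a..<k} = {j \<in> S. j < k} \<union> \<Union> (span ` C')"
      using below k unfolding S_def C'_def by (auto, blast)
    have fin: "finite C'" using C(1) by (simp add: C'_def)
    have "card (\<Union> (span ` C')) = (\<Sum>\<beta>\<in>C'. card (span \<beta>))"
      using fin C(4) by (intro card_UN_disjoint) (auto simp: C'_def intro: finite_subset)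
    then have dvd: "T dvd card (\<Union> (span ` C'))"
      using C(3) by (auto simp: C'_def intro: dvd_sum)
    have "finite (\<Union> (span ` C'))"
      using union by (metis finite_Un finite_atLeastLessThan)
    then have "card {a..<k} = card {j \<in> S. j < k} + card (\<Union> (span ` C'))"
      unfolding union by (intro card_Un_disjoint) (auto simp: S_def C'_def)
    with dvd show "T dvd k - a - card {j \<in> S. j < k}" "card {j \<in> S. j < k} \<le> k - a"
      by auto
  qed
  have "nths z S ! i = nths z S ! (i + T)" if i: "i + T < length (nths z S)" for i
  proof -
    obtain k where k: "k \<in> S" "nths z S ! i = z ! k" "card {j \<in> S. j < k} = i"
      using nth_nths[of i z S] i by auto
    obtain k' where k': "k' \<in> S" "nths z S ! (i + T) = z ! k'" "card {j \<in> S. j < k'} = i + T"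
      using nth_nths[OF i] by auto
    have "k \<le> k'"
    proof (rule ccontr)
      assume "\<not> k \<le> k'"
      then have "card {j \<in> S. j < k'} \<le> card {j \<in> S. j < k}"
        by (intro card_mono) auto
      then show False using k(3) k'(3) T(1) by linarith
    qed
    have "a \<le> k" "a \<le> k'" "k' < b"
      using k(1) k'(1) by (auto simp: S_def)
    have "T dvd k - a - i" "i \<le> k - a"
      using shift[OF k(1)] by (simp_all only: k(3))
    moreover have "T dvd k' - a - (i + T)" "i + T \<le> k' - a"
      using shift[OF k'(1)] by (simp_all only: k'(3))
    \<comment> \<open>Modulo \<open>T\<close>, both offsets from \<open>a\<close> are congruent to
      their ranks, which differ by \<open>T\<close>; the added \<open>T\<close> compensates this
      difference.\<close>
    ultimately have "T dvd k' - a - (i + T) + T - (k - a - i)"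
      by (meson dvd_add dvd_diff_nat dvd_refl)
    moreover have "k' - a - (i + T) + T - (k - a - i) = k' - k"
      using \<open>i \<le> k - a\<close> \<open>i + T \<le> k' - a\<close> \<open>a \<le> k\<close> \<open>k \<le> k'\<close> by simp
    ultimately have "T dvd k' - k"
      by simp
    then show ?thesis
      using period_cong_mod[of a T b z k k'] T(2) k k' \<open>k \<le> k'\<close> \<open>a \<le> k\<close> \<open>k' < b\<close> by auto
  qed
  with T(1) len show ?thesis by (simp add: w has_period_def)
qed

section \<open>Bursts caused by the deleted reads\<close>

text \<open>\<open>js\<close> holds the start positions, counted from 0, of the surviving reads of
  \<open>X\<close>; the conditions on its ends say that the first and last reads are kept.\<close>

locale surviving_reads =
  fixes l :: nat and X js :: "nat list"
  assumes l_pos: "0 < l" and js_nonempty: "js \<noteq> []" and js_sorted: "sorted_wrt (<) js"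
    and js_first: "hd js = 0" and js_last: "last js + l = length X"
begin

definition "R = map (\<lambda>j. take l (drop j X)) js"
definition "g i = gap l (R ! i) (R ! (i + 1))"
definition "\<delta> i = js ! (i + 1) - js ! i - 1 - g i"
text \<open>\<open>\<delta> i\<close> is the excess of the true distance over the glued distance
  \<open>g i + 1\<close>. It is deleted right behind read \<open>i\<close>, so that read stays
  complete, as do the last \<open>g i + 1\<close> symbols of the next one.\<close>

definition "burst i = (js ! i + l, js ! i + l + \<delta> i)"
text \<open>Zero excess is left out since \<open>bursts\<close> demands nonempty spans.\<close>

definition "I = {i. i < length js - 1 \<and> 0 < \<delta> i}"
definition "B = burst ` I"

section \<open>Positions of the surviving reads and of the bursts\<close>

lemma js_less: "i < j \<Longrightarrow> j < length js \<Longrightarrow> js ! i < js ! j"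
  using js_sorted by (simp add: sorted_wrt_nth_less)

lemma js_mono: "i \<le> j \<Longrightarrow> j < length js \<Longrightarrow> js ! i \<le> js ! j"
  using js_less[of i j] by (cases "i = j") auto

lemma js_last_nth: "last js = js ! (length js - 1)"
  using js_nonempty by (rule last_conv_nth)

lemma js_bound:
  assumes "i < length js"
  shows "js ! i + l \<le> length X"
proof -
  have "js ! i \<le> last js"
    unfolding js_last_nth using assms by (intro js_mono) auto
  with js_last show ?thesis by simp
qed

lemma length_R [simp]: "length R = length js"
  by (simp add: R_def)

lemma nth_R: "i < length js \<Longrightarrow> R ! i = take l (drop (js ! i) X)"
  by (simp add: R_def)

lemma length_nth_R: "i < length js \<Longrightarrow> length (R ! i) = l"
  using js_bound[of i] by (simp add: nth_R)

text \<open>Both reads are windows of \<open>X\<close>, so their true distance is a candidate in the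
  definition of \<open>gap\<close>; hence the truncated subtraction in \<open>\<delta>\<close> is
  exact.\<close>

lemma js_step:
  assumes "i < length js - 1"
  shows "js ! (i + 1) = js ! i + 1 + g i + \<delta> i"
proof -
  define k where "k = js ! (i + 1) - js ! i - 1"
  have k: "js ! (i + 1) = js ! i + (k + 1)"
    using js_less[of i "i + 1"] assms by (simp add: k_def less_diff_conv)
  have "drop (k + 1) (R ! i) = take (l - (k + 1)) (R ! (i + 1))"
    using assms nth_R[of i] nth_R[of "i + 1"] k by (simp add: drop_take add.commute)
  then have "g i \<le> k"
    unfolding g_def by (rule gap_le)
  with k show ?thesis
    by (simp add: \<delta>_def)
qed

lemma g_less: "i < length js - 1 \<Longrightarrow> g i < l"
  unfolding g_def by (intro gap_less l_pos length_nth_R) simp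

lemma burst_end_le:
  assumes "i < j" "j < length js"
  shows "js ! i + l + \<delta> i \<le> js ! j + l"
  using js_step[of i] js_mono[of "i + 1" j] assms by simp

lemma burst_end_bound: "i < length js - 1 \<Longrightarrow> js ! i + l + \<delta> i \<le> length X"
  using burst_end_le[of i "i + 1"] js_bound[of "i + 1"] by (simp add: less_diff_conv)

lemma bursts_disjoint:
  assumes "i \<in> I" "j \<in> I" "i \<noteq> j"
  shows "span (burst i) \<inter> span (burst j) = {}"
proof -
  have "span (burst i) \<inter> span (burst j) = {}" if "i < j" "j \<in> I" for i j
    using burst_end_le[of i j] that by (auto simp: burst_def I_def less_diff_conv)
  from this[of i j] this[of j i] assms show ?thesis
    by (cases "i < j") auto
qed

lemma span_burst_nonempty: "i \<in> I \<Longrightarrow> span (burst i) \<noteq> {}"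
  by (simp add: I_def burst_def)

lemma inj_on_burst: "inj_on burst I"
  using bursts_disjoint span_burst_nonempty by (metis inf.idem inj_onI)

lemma finite_I [simp]: "finite I"
  by (simp add: I_def)

lemma bursts_B: "bursts X B"
proof -
  have "span (burst i) \<subseteq> {..<length X}" if "i \<in> I" for i
    using burst_end_bound[of i] that by (auto simp: I_def burst_def)
  moreover have "span (burst i) \<inter> span (burst j) = {}"
    if "i \<in> I" "j \<in> I" "burst i \<noteq> burst j" for i j
    using bursts_disjoint that by metis
  ultimately show ?thesis
    using span_burst_nonempty by (simp add: bursts_def B_def)
qed

lemma sum_card_bursts: "(\<Sum>\<beta>\<in>B. card (span \<beta>)) = (\<Sum>i<length js - 1. \<delta> i)"
proof -
  have "(\<Sum>\<beta>\<in>B. card (span \<beta>)) = (\<Sum>i\<in>I. \<delta> i)"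
    unfolding B_def by (subst sum.reindex[OF inj_on_burst]) (simp add: burst_def)
  also have "\<dots> = (\<Sum>i<length js - 1. \<delta> i)"
    by (rule sum.mono_neutral_left) (auto simp: I_def)
  finally show ?thesis .
qed

lemma total_gap_R: "total_gap l R = (\<Sum>i<length js - 1. g i)"
  by (simp add: total_gap_def g_def)

text \<open>Telescopes \<open>js_step\<close>. As \<open>last js + 1\<close> counts all reads of
  \<open>X\<close>, the bursts have total length \<open>t - s\<close>.\<close>

lemma total_deleted: "(\<Sum>i<length js - 1. \<delta> i) + total_gap l R + length js = last js + 1"
proof -
  have "(\<Sum>i<n. \<delta> i) + (\<Sum>i<n. g i) + n = js ! n" if "n < length js" for n
    using that
  proof (induction n)
    case 0
    then show ?case using js_first js_nonempty by (simp add: hd_conv_nth)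
  next
    case (Suc n)
    then show ?case using js_step[of n] by simp
  qed
  moreover obtain m where "length js = Suc m"
    using js_nonempty by (cases "length js") auto
  ultimately show ?thesis
    by (simp add: total_gap_R js_last_nth)
qed

text \<open>The block from the end of read \<open>n\<close> to the end of read \<open>n + 1\<close>
  has \<open>1 + g n + \<delta> n\<close> symbols. Earlier bursts end before it and later ones begin
  behind it.\<close>

lemma mem_bursts_iff:
  assumes n: "n < length js - 1" and j: "j < 1 + g n + \<delta> n"
  shows "js ! n + l + j \<in> \<Union> (span ` B) \<longleftrightarrow> j < \<delta> n"
proof
  assume "js ! n + l + j \<in> \<Union> (span ` B)"
  then obtain i where i: "i \<in> I" "js ! i \<le> js ! n + j" "js ! n + j < js ! i + \<delta> i"
    by (auto simp: B_def burst_def)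
  have "\<not> i < n"
    using i burst_end_le[of i n] n by (auto simp: less_diff_conv)
  moreover have "\<not> n < i"
    using i js_mono[of "n + 1" i] js_step[OF n] j by (auto simp: I_def less_diff_conv)
  ultimately show "j < \<delta> n"
    using i by (metis nat_add_left_cancel_less nat_neq_iff)
next
  assume "j < \<delta> n"
  with n show "js ! n + l + j \<in> \<Union> (span ` B)"
    by (auto simp: B_def I_def burst_def intro!: bexI[of _ n])
qed

lemma glue_R: "glue l R = after_bursts X (0, length X) B"
proof -
  define U where "U = \<Union> (span ` B)"
  define tail where "tail = (\<lambda>i. drop (l - Suc (g i)) (R ! (i + 1)))"
  \<comment> \<open>Induction along the prefixes that end with a surviving read; each step adds one
    block as in \<open>mem_bursts_iff\<close>.\<close>
  have "nths (take (js ! n + l) X) (- U) = hd R @ concat (map tail [0..<n])"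
    if "n < length js" for n
    using that
  proof (induction n)
    case 0
    have "js ! 0 = 0"
      using js_first js_nonempty by (simp add: hd_conv_nth)
    moreover have "i \<notin> U" if "i < l" for i
      using that by (auto simp: U_def B_def burst_def)
    ultimately show ?case
      using js_nonempty nth_R[of 0] by (simp add: nths_all hd_conv_nth flip: length_greater_0_conv)
  next
    case (Suc n)
    let ?new = "take (1 + g n + \<delta> n) (drop (js ! n + l) X)"
    have n: "n < length js - 1" using Suc.prems by simp
    have step: "js ! Suc n + l = (js ! n + l) + (1 + g n + \<delta> n)"
      using js_step[OF n] by simp
    have len: "length (take (js ! n + l) X) = js ! n + l"
      using js_bound[of n] n by simp
    have "j + (js ! n + l) \<in> U \<longleftrightarrow> j < \<delta> n" if "j < 1 + g n + \<delta> n" for j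
      using mem_bursts_iff[OF n that] by (simp only: U_def ac_simps)
    then have "nths ?new {j. j + (js ! n + l) \<in> - U} = nths ?new {j. j \<ge> \<delta> n}"
      unfolding nths_eq_map_filter
      by (intro arg_cong[of _ _ "map _"] filter_cong) (auto simp: not_less)
    also have "\<dots> = take (Suc (g n)) (drop (js ! n + l + \<delta> n) X)"
      by (simp add: drop_take ac_simps flip: drop_eq_nths)
    \<comment> \<open>The \<open>Suc (g n)\<close> kept symbols end where read \<open>n + 1\<close>
      ends, and lie inside it because \<open>g n < l\<close>.\<close>
    also have "\<dots> = tail n"
      using js_step[OF n] g_less[OF n] n nth_R[of "Suc n"]
      by (simp add: tail_def drop_take ac_simps)
    finally have new: "nths ?new {j. j + (js ! n + l) \<in> - U} = tail n" .
    have "nths (take (js ! Suc n + l) X) (- U) = nths (take (js ! n + l) X) (- U) @ tail n"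
      unfolding step take_add[of "js ! n + l" "1 + g n + \<delta> n"] nths_append len by (subst new) (rule refl)
    then show ?case
      using Suc by simp
  qed
  from this[of "length js - 1"] have "nths X (- U) = glue l R"
    using js_nonempty js_last by (simp add: glue_def tail_def g_def last_conv_nth)
  moreover have "nths X (- U) = nths X ({0..<length X} - U)"
    unfolding nths_eq_map_filter by (intro arg_cong[of _ _ "map _"] filter_cong) auto
  ultimately show ?thesis
    by (simp add: after_bursts_def U_def)
qed

text \<open>If the minimal insertion between two surviving reads is shorter than the true one, then the
  reads overlap in two different ways, and the difference of the shifts is a period of the part of
  \<open>X\<close> that they cover.\<close>

lemma overlap_period:
  assumes "i \<in> I" "g i < l - 1"
  shows "has_period (substring X (js ! i + g i + 1, js ! i + l + \<delta> i)) (\<delta> i)"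
proof -
  have i: "i < length js - 1" "0 < \<delta> i" using assms by (auto simp: I_def)
  have overlap: "drop (g i + 1) (R ! i) = take (l - (g i + 1)) (R ! (i + 1))"
    unfolding g_def using i by (intro gap_overlap length_nth_R) simp
  have "X ! p = X ! (p + \<delta> i)" if p: "js ! i + g i + 1 \<le> p" "p < js ! i + l" for p
  proof -
    define m where "m = p - (js ! i + g i + 1)"
    have m: "p = js ! i + g i + 1 + m" "m < l - (g i + 1)"
      using p by (auto simp: m_def)
    have "js ! i + l \<le> length X"
      using i by (intro js_bound) simp
    then have "drop (g i + 1) (R ! i) ! m = X ! p"
      using i m by (simp add: nth_R drop_take ac_simps)
    moreover have "js ! (i + 1) + l \<le> length X"
      using i by (intro js_bound) simp
    \<comment> \<open>In \<open>X\<close> the next read starts \<open>\<delta> i\<close> positions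
      to the right of its glued place.\<close>
    then have "take (l - (g i + 1)) (R ! (i + 1)) ! m = X ! (p + \<delta> i)"
      using i m js_step[OF i(1)] by (simp add: nth_R ac_simps)
    ultimately show ?thesis using overlap by simp
  qed
  \<comment> \<open>By \<open>g i < l - 1\<close> the overlap is nonempty, so the substring is
    longer than its period, as \<open>has_period\<close> demands.\<close>
  then show ?thesis
    using i assms(2) burst_end_bound[OF i(1)] by (auto simp: has_period_substring_iff)
qed

text \<open>The substring of \<open>overlap_period\<close> has length
  \<open>l - 1 - g i + \<delta> i\<close>, so \<open>T \<le> l - 1 - g i\<close> is exactly what
  \<open>min_period_dvd\<close> asks for. Its maximal extension keeps the minimum period.\<close>

lemma periodic_substring_of_burst:
  assumes "i \<in> I" "g i < l - 1"
  shows "\<exists>a b T. a \<le> js ! i + g i + 1 \<and> js ! i + l + \<delta> i \<le> b \<and> b \<le> length X \<and>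
    maximal_periodic_min X T (a, b) \<and> T \<le> \<delta> i \<and> (T \<le> l - 1 - g i \<longrightarrow> T dvd \<delta> i)"
proof -
  let ?w = "substring X (js ! i + g i + 1, js ! i + l + \<delta> i)"
  have b: "js ! i + l + \<delta> i \<le> length X"
    using assms(1) burst_end_bound by (simp add: I_def)
  note per = overlap_period[OF assms]
  obtain a b where "a \<le> js ! i + g i + 1" "js ! i + l + \<delta> i \<le> b" "b \<le> length X"
    "maximal_periodic_min X (min_period ?w) (a, b)"
    using maximal_periodic_min_extension[OF b per] by blast
  moreover have "min_period ?w \<le> \<delta> i"
    using min_period_properties(2)[OF per] .
  moreover have "length ?w = l - 1 - g i + \<delta> i"
    using b assms(2) by (simp add: length_substring)
  ultimately show ?thesis
    using min_period_dvd[OF per] by (metis add_le_mono1)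
qed

section \<open>Attributing the bursts to maximal periodic substrings\<close>

lemma g_le_total: "i \<in> I \<Longrightarrow> g i \<le> total_gap l R"
  unfolding total_gap_R I_def by (intro member_le_sum) auto

lemma \<delta>_le_total: "i \<in> I \<Longrightarrow> \<delta> i \<le> (\<Sum>i<length js - 1. \<delta> i)"
  unfolding I_def by (intro member_le_sum) auto

text \<open>With \<open>s < l - 1\<close> every gap is below \<open>l - 1\<close>, so every burst
  has periodic surroundings; \<open>P\<close> picks one maximal substring for each. As
  \<open>s + d\<close> will be \<open>t\<close>, the bound \<open>s + d \<le> l - 2\<close> is the
  regime of complete periods.\<close>

lemma periodic_substrings:
  defines "s \<equiv> total_gap l R" and "d \<equiv> (\<Sum>i<length js - 1. \<delta> i)"
  assumes s: "s < l - 1"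
  shows "\<exists>P.
    (\<forall>\<beta>\<in>B. span \<beta> \<subseteq> span (P \<beta>) \<and> (\<exists>T\<le>d. maximal_periodic_min X T (P \<beta>))) \<and>
    (\<forall>p\<in>P ` B. l - 1 - s \<le> length (after_bursts X p (bursts_in B P p))) \<and>
    (s + d \<le> l - 2 \<longrightarrow>
      (\<forall>\<beta>\<in>B. min_period (substring X (P \<beta>)) dvd card (span \<beta>)) \<and>
      (\<forall>p\<in>P ` B. has_period (after_bursts X p (bursts_in B P p)) (min_period (substring X p))))"
proof -
  have gs: "g i \<le> s" and \<delta>d: "\<delta> i \<le> d" if "i \<in> I" for i
    using that g_le_total \<delta>_le_total by (auto simp: s_def d_def)
  \<comment> \<open>The bound on \<open>a\<close> puts into the substring not only the burst but
    also the overlap symbols in front of it, which will survive.\<close>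
  define spec where "spec i p \<longleftrightarrow> (\<exists>a b T. p = (a, b) \<and> a \<le> js ! i + g i + 1 \<and>
    js ! i + l + \<delta> i \<le> b \<and> b \<le> length X \<and> maximal_periodic_min X T p \<and>
    T \<le> \<delta> i \<and> (T \<le> l - 1 - g i \<longrightarrow> T dvd \<delta> i))" for i p
  have "\<exists>p. spec i p" if "i \<in> I" for i
    unfolding spec_def using periodic_substring_of_burst[OF that] gs[OF that] s by fastforce
  then obtain F where F: "\<And>i. i \<in> I \<Longrightarrow> spec i (F i)"
    by metis
  define P where "P \<beta> = F (inv_into I burst \<beta>)" for \<beta>
  have P: "spec i (P (burst i))" if "i \<in> I" for i
    using F that inj_on_burst by (simp add: P_def)
  have finB: "finite B" by (simp add: B_def)
  have inside: "span \<beta> \<subseteq> span (P \<beta>)" "\<exists>T\<le>d. maximal_periodic_min X T (P \<beta>)" if \<beta>: "\<beta> \<in> B" for \<beta>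
  proof -
    obtain i where i: "i \<in> I" "\<beta> = burst i"
      using \<beta> by (auto simp: B_def)
    have "g i < l" using g_less i by (simp add: I_def)
    with P[OF i(1)] show "span \<beta> \<subseteq> span (P \<beta>)"
      unfolding i(2) spec_def by (auto simp: burst_def)
    show "\<exists>T\<le>d. maximal_periodic_min X T (P \<beta>)"
      using P[OF i(1)] \<delta>d[OF i(1)] unfolding i(2) spec_def by (meson order_trans)
  qed
  have long: "l - 1 - s \<le> length (after_bursts X p (bursts_in B P p))" if "p \<in> P ` B" for p
  proof -
    define J where "J = {i \<in> I. P (burst i) = p}"
    \<comment> \<open>The leftmost burst attributed to \<open>p\<close>: no burst attributed to
      \<open>p\<close> touches the \<open>l - 1 - g i\<close> overlap symbols in front of
      it.\<close>
    define i where "i = Min J"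
    have J: "finite J" "J \<noteq> {}"
      using that by (auto simp: J_def B_def)
    then have i: "i \<in> I" "P (burst i) = p" and least: "\<And>j. j \<in> J \<Longrightarrow> i \<le> j"
      using Min_in[OF J] by (auto simp: i_def J_def)
    obtain a b where p: "p = (a, b)" "a \<le> js ! i + g i + 1" "js ! i + l + \<delta> i \<le> b"
      using P[OF i(1)] i(2) by (auto simp: spec_def)
    have "k \<notin> span \<beta>" if k: "k < js ! i + l" and \<beta>: "\<beta> \<in> bursts_in B P p" for k \<beta>
    proof -
      obtain j where j: "j \<in> I" "\<beta> = burst j" "P (burst j) = p"
        using \<beta> by (auto simp: bursts_in_def B_def)
      then have "js ! i \<le> js ! j"
        using least[of j] by (intro js_mono) (auto simp: J_def I_def)
      with k show ?thesis by (auto simp: j burst_def)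
    qed
    moreover have "js ! i + l \<le> length X"
      using i(1) by (intro js_bound) (auto simp: I_def)
    then have "{js ! i + g i + 1..<js ! i + l} \<subseteq> {..<length X} \<inter> span p"
      using p by auto
    ultimately have "{js ! i + g i + 1..<js ! i + l} \<subseteq>
      {k. k < length X \<and> k \<in> span p - \<Union> (span ` bursts_in B P p)}"
      by fastforce
    then have "card {js ! i + g i + 1..<js ! i + l} \<le> length (after_bursts X p (bursts_in B P p))"
      unfolding after_bursts_def length_nths by (intro card_mono) auto
    with gs[OF i(1)] show ?thesis by simp
  qed
  have dvd: "min_period (substring X (P \<beta>)) dvd card (span \<beta>)" if \<beta>: "\<beta> \<in> B" and sd: "s + d \<le> l - 2" for \<beta>
  proof -
    obtain i where i: "i \<in> I" "\<beta> = burst i"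
      using \<beta> by (auto simp: B_def)
    \<comment> \<open>The period in \<open>spec\<close> is at most \<open>\<delta> i\<close>, so
      this activates the divisibility stated there.\<close>
    have "\<delta> i \<le> l - 1 - g i"
      using gs[OF i(1)] \<delta>d[OF i(1)] sd by simp
    with P[OF i(1)] show ?thesis
      unfolding i(2) spec_def maximal_periodic_min_def by (auto simp: burst_def)
  qed
  have period: "has_period (after_bursts X p (bursts_in B P p)) (min_period (substring X p))"
    if p: "p \<in> P ` B" and sd: "s + d \<le> l - 2" for p
  proof -
    obtain a b where ab: "p = (a, b)" by fastforce
    obtain i T where i: "i \<in> I" "b \<le> length X" "maximal_periodic_min X T p" "T \<le> \<delta> i"
      using p P by (fastforce simp: B_def spec_def ab)
    then have per: "has_period (substring X p) (min_period (substring X p))"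
      "min_period (substring X p) \<le> \<delta> i"
      by (auto simp: maximal_periodic_min_def maximal_periodic_def)
    \<comment> \<open>The period is at most \<open>\<delta> i \<le> d \<le> l - 2 - s\<close>, while
      at least \<open>l - 1 - s\<close> symbols survive.\<close>
    have "min_period (substring X p) < length (after_bursts X p (bursts_in B P p))"
      using per(2) \<delta>d[OF i(1)] sd s long[OF p] by linarith
    moreover have "finite (bursts_in B P p)"
      using finB by (simp add: bursts_in_def)
    moreover have "span \<beta> \<subseteq> {a..<b}" "min_period (substring X p) dvd card (span \<beta>)"
      if "\<beta> \<in> bursts_in B P p" for \<beta>
      using that inside(1)[of \<beta>] dvd[of \<beta>] sd by (auto simp: bursts_in_def ab)
    moreover have "span \<beta> \<inter> span \<gamma> = {}"
      if "\<beta> \<in> bursts_in B P p" "\<gamma> \<in> bursts_in B P p" "\<beta> \<noteq> \<gamma>" for \<beta> \<gamma>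
      using that bursts_B unfolding bursts_in_def bursts_def by blast
    ultimately show ?thesis
      using per(1) i(2) unfolding ab by (intro has_period_after_bursts) auto
  qed
  show ?thesis
    using inside long dvd period by blast
qed

end

section \<open>From deleted reads to surviving start positions\<close>

lemma deletes_lmers_surviving_reads:
  assumes "deletes_lmers t (reads l X) R'" "0 < l" "l < length X"
  obtains js where "surviving_reads l X js" "R' = map (\<lambda>j. take l (drop j X)) js"
    "length js + t = length X + 1 - l"
proof -
  define M where "M = length X + 1 - l"
  have len: "length (reads l X) = M"
    by (simp add: reads_def M_def)
  obtain D where D: "D \<subseteq> {1..<M - 1}" "card D = t" "R' = nths (reads l X) (- D)"
    using assms(1) unfolding deletes_lmers_def len by blast
  define js where "js = filter (\<lambda>i. i \<notin> D) [0..<M]"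
  have M: "2 \<le> M" using assms by (simp add: M_def)
  have "D \<subseteq> {..<M}" using D(1) by fastforce
  have "R' = map ((!) (reads l X)) js"
    unfolding D(3) nths_eq_map_filter by (simp add: js_def len)
  also have "\<dots> = map (\<lambda>j. take l (drop j X)) js"
    by (rule map_cong) (auto simp: js_def reads_def M_def)
  finally have R': "R' = map (\<lambda>j. take l (drop j X)) js" .
  \<comment> \<open>Splitting off either end of the index range shows the ends of \<open>js\<close>,
    because \<open>D\<close> contains neither \<open>0\<close> nor \<open>M - 1\<close>.\<close>
  have "[0..<M] = 0 # [1..<M]"
    using M by (simp add: upt_conv_Cons)
  then have hd: "hd js = 0" "js \<noteq> []"
    using D(1) by (auto simp: js_def)
  have "[0..<M] = [0..<M - 1] @ [M - 1]"
    using M by (metis Suc_1 Suc_diff_1 le0 less_le_trans upt_Suc_append zero_less_Suc)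
  then have last: "last js = M - 1"
    using D(1) M by (auto simp: js_def)
  have "distinct js" by (simp add: js_def)
  then have "length js = card (set js)" by (simp add: distinct_card)
  also have "set js = {..<M} - D" by (auto simp: js_def)
  also have "card \<dots> = M - t"
    using D(2) \<open>D \<subseteq> {..<M}\<close> by (subst card_Diff_subset) (auto intro: finite_subset)
  finally have "length js = M - t" .
  moreover have "card D \<le> card {1..<M - 1}"
    by (rule card_mono) (use D(1) in auto)
  ultimately have "length js + t = M"
    using D(2) M by simp
  moreover have "surviving_reads l X js"
  proof
    show "sorted_wrt (<) js" unfolding js_def by (simp add: sorted_wrt_filter)
    show "last js + l = length X" using assms by (simp add: last M_def)
  qed (use assms hd in auto)
  ultimately show ?thesis
    using that R' by (simp add: M_def)
qed

theorem mainTheorem10: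
  fixes q l n t :: nat and u x v :: "nat list" and R' :: "nat list list"
  assumes "q \<ge> 2" and "l \<ge> 2" and "t \<ge> 1"
    and "x \<in> words q n" and "u \<in> words q l" and "v \<in> words q l"
    and "deletes_lmers t (reads l (u @ x @ v)) R'"
  shows
    "let X = u @ x @ v; s = min_insertions q l R' in
       (\<exists>R''. consistent_insertion q l s R' R'') \<and> s \<le> t \<and>
       s = (\<Sum>i<length R' - 1. gap l (R' ! i) (R' ! (i + 1))) \<and>
       (\<forall>R''. consistent_insertion q l s R' R'' \<longrightarrow>
         (\<exists>B P. bursts X B \<and>
            read_inverse R'' = after_bursts X (0, length X) B \<and>
            (\<Sum>\<beta>\<in>B. card (span \<beta>)) = t - s \<and>
            (s < min (l - 1) t \<longrightarrow>
               (\<forall>\<beta>\<in>B. span \<beta> \<subseteq> span (P \<beta>) \<and>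
                  (\<exists>T\<le>t - s. maximal_periodic_min X T (P \<beta>)))) \<and>
            (s < t \<and> t \<le> l - 2 \<longrightarrow>
               (\<forall>p\<in>P ` B.
                  min_period (substring X p) dvd (\<Sum>\<beta>\<in>bursts_in B P p. card (span \<beta>)) \<and>
                  (\<forall>\<beta>\<in>bursts_in B P p. min_period (substring X p) dvd card (span \<beta>)))) \<and>
            (s < min (l - 1) t \<longrightarrow>
               (\<forall>p\<in>P ` B. length (after_bursts X p (bursts_in B P p)) \<ge> l - 1 - s)) \<and>
            (s < t \<and> t \<le> l - 2 \<longrightarrow>
               (\<forall>p\<in>P ` B.
                  has_period (after_bursts X p (bursts_in B P p)) (min_period (substring X p))))))"
proof -
  define X where "X = u @ x @ v"
  have X: "l < length X" "set X \<subseteq> {..<q}"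
    using assms by (auto simp: X_def words_def)
  have l: "0 < l" using assms(2) by simp
  obtain js where js: "surviving_reads l X js" "R' = map (\<lambda>j. take l (drop j X)) js"
    "length js + t = length X + 1 - l"
    using deletes_lmers_surviving_reads[of t l X R'] assms(7) X(1) l unfolding X_def by blast
  interpret surviving_reads l X js by (rule js(1))
  have R': "R' = R" by (simp add: js(2) R_def)
  define s where "s = min_insertions q l R'"
  have "set R' \<subseteq> words q l"
  proof
    fix w assume "w \<in> set R'"
    then obtain i where i: "i < length js" "w = R ! i"
      unfolding R' by (metis in_set_conv_nth length_R)
    have "set w \<subseteq> set X"
      unfolding i(2) nth_R[OF i(1)] by (meson order_trans set_drop_subset set_take_subset)
    with i X(2) show "w \<in> words q l"
      by (simp add: words_def length_nth_R)
  qed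
  moreover have "R' \<noteq> []" using js_nonempty by (simp add: js(2))
  ultimately have s: "s = total_gap l R'" and ex: "\<exists>R''. consistent_insertion q l s R' R''"
    using min_insertions_eq[of R' q l] l by (simp_all add: s_def)
  have d: "(\<Sum>i<length js - 1. \<delta> i) + s = t"
    using total_deleted js(3) js_last l by (simp add: s R')
  have s_eq: "s = (\<Sum>i<length R' - 1. gap l (R' ! i) (R' ! (i + 1)))"
    by (simp add: s total_gap_def)
  have inv: "read_inverse R'' = after_bursts X (0, length X) B"
    if "consistent_insertion q l s R' R''" for R''
    using read_inverse_min_insertion[of q l R' R''] that l \<open>R' \<noteq> []\<close> glue_R by (simp add: s R')
  have sum: "(\<Sum>\<beta>\<in>B. card (span \<beta>)) = t - s"
    using d by (simp add: sum_card_bursts)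
  have "\<exists>P.
      (s < min (l - 1) t \<longrightarrow>
        (\<forall>\<beta>\<in>B. span \<beta> \<subseteq> span (P \<beta>) \<and> (\<exists>T\<le>t - s. maximal_periodic_min X T (P \<beta>)))) \<and>
      (s < t \<and> t \<le> l - 2 \<longrightarrow>
        (\<forall>p\<in>P ` B.
          min_period (substring X p) dvd (\<Sum>\<beta>\<in>bursts_in B P p. card (span \<beta>)) \<and>
          (\<forall>\<beta>\<in>bursts_in B P p. min_period (substring X p) dvd card (span \<beta>)))) \<and>
      (s < min (l - 1) t \<longrightarrow>
        (\<forall>p\<in>P ` B. length (after_bursts X p (bursts_in B P p)) \<ge> l - 1 - s)) \<and>
      (s < t \<and> t \<le> l - 2 \<longrightarrow>
        (\<forall>p\<in>P ` B.
          has_period (after_bursts X p (bursts_in B P p)) (min_period (substring X p))))"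
    (is "\<exists>P. ?in_runs P \<and> ?dvd P \<and> ?long P \<and> ?period P")
  proof (cases "s < l - 1")
    case True
    \<comment> \<open>This turns the bound \<open>s + d \<le> l - 2\<close> of
      \<open>periodic_substrings\<close> into \<open>t \<le> l - 2\<close>.\<close>
    have "(\<Sum>i<length js - 1. \<delta> i) = t - s" "s + (t - s) = t"
      using d by simp_all
    with periodic_substrings True obtain P where P:
      "\<forall>\<beta>\<in>B. span \<beta> \<subseteq> span (P \<beta>) \<and> (\<exists>T\<le>t - s. maximal_periodic_min X T (P \<beta>))"
      "\<forall>p\<in>P ` B. l - 1 - s \<le> length (after_bursts X p (bursts_in B P p))"
      "t \<le> l - 2 \<Longrightarrow> \<forall>\<beta>\<in>B. min_period (substring X (P \<beta>)) dvd card (span \<beta>)"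
      "t \<le> l - 2 \<Longrightarrow>
        \<forall>p\<in>P ` B. has_period (after_bursts X p (bursts_in B P p)) (min_period (substring X p))"
      unfolding s R' by metis
    from P(3) have "min_period (substring X p) dvd card (span \<beta>)"
      if "t \<le> l - 2" "\<beta> \<in> bursts_in B P p" for p \<beta>
      using that by (auto simp: bursts_in_def)
    then have "t \<le> l - 2 \<Longrightarrow> \<forall>p. min_period (substring X p) dvd (\<Sum>\<beta>\<in>bursts_in B P p. card (span \<beta>)) \<and>
        (\<forall>\<beta>\<in>bursts_in B P p. min_period (substring X p) dvd card (span \<beta>))"
      by (meson dvd_sum)
    with P(1,2,4) show ?thesis
      by (intro exI[of _ P]) blast
  next
    case False
    \<comment> \<open>For \<open>s \<ge> l - 1\<close> the premises of all four claims fail, so any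
      \<open>P\<close> will do.\<close>
    then have "\<not> s < min (l - 1) t" "\<not> (s < t \<and> t \<le> l - 2)" by auto
    then show ?thesis by blast
  qed
  then obtain P where P: "?in_runs P" "?dvd P" "?long P" "?period P"
    by (elim exE conjE) (rule that)
  have "s \<le> t" using d by simp
  show ?thesis
    unfolding Let_def X_def[symmetric] s_def[symmetric]
    by (intro conjI ex s_eq \<open>s \<le> t\<close> allI, rule impI)
      (intro exI[of _ B] exI[of _ P] conjI bursts_B inv sum P)
qed

end
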